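(* Let $D$ be a subquantale of $([0,1],\bigvee,\odot)$. The functor $\Omega:\mathbf{Top}(D)\to\mathbf{Frm}(D)^{\mathrm{op}}$ is left adjoint to the functor $\operatorname{pt}:\mathbf{Frm}(D)^{\mathrm{op}}\to\mathbf{Top}(D)$, with unit $\eta_X:X\to\operatorname{pt}\Omega(X)$, $\eta_X(x)=\Omega(\mathbf x)$ (the map $\alpha\mapsto\alpha(x)$), for each $D$-laminated MV-space $(X,\Omega(X))$, and with counit given, for each $D$-frame $M$, by the $D$-frame homomorphism $\varepsilon_M:M\to\Omega(\operatorname{pt}M)$, $a\mapsto\widehat a$ (regarded as a morphism $\Omega(\operatorname{pt}M)\to M$ in $\mathbf{Frm}(D)^{\mathrm{op}}$).
   Context: $[0,1]$ carries the MV-algebra operations $x\oplus y=\min\{1,x+y\}$, $x\odot y=\max\{0,x+y-1\}$, usual order. A subquantale $D$ of $[0,1]$ is a subset closed under arbitrary suprema and $\odot$. Operations on $[0,1]^X$ are pointwise; $\mathbf 1,\mathbf 0$ are constant functions. A $D$-laminated MV-space is a pair $(X,\tau)$ with $\tau\subseteq[0,1]^X$ such that $\mathbf 1\in\tau$, $\tau$ is closed under arbitrary suprema, $r\odot o\in\tau$ for $r\in D$, $o\in\tau$, and $\tau$ is closed under binary $\odot,\oplus,\wedge$. A map $f:X\to Y$ between such spaces is continuous if $\alpha\circ f\in\tau_X$ for all $\alpha\in\tau_Y$; $\mathbf{Top}(D)$ is the category of $D$-laminated MV-spaces and continuous maps. A $D$-algebra is $(M,\cdot,* )$ with $M$ a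 complete lattice, $(M,\cdot)$ a quantale, $*:D\times M\to M$ a unital module action distributing over joins in both variables with $(q\odot r)*a=q*(r*a)$, and $q*(a\cdot b)=(q*a)\cdot b=a\cdot(q*b)$. A $D$-frame is $(M,\bigvee,\wedge,*,\cdot,+,1,0)$ with $(M,\cdot,* )$ a $D$-algebra, $(M,\bigvee,\wedge,1)$ a frame, and $(M,+,0)$ a commutative monoid with $a+(b\wedge c)=(a+b)\wedge(a+c)$. $D$-frame homomorphisms preserve $1$, arbitrary joins, scalar multiplication, $\cdot$, $+$ and binary $\wedge$; $\mathbf{Frm}(D)$ is the resulting category. $[0,1]$ is a $D$-frame with $\sup,\min$, $r*x=r\odot x$, $\cdot=\odot$, $+=\oplus$. A point of a $D$-frame $M$ is a $D$-frame homomorphism $M\to[0,1]$; $\operatorname{pt}M$ is the set of points, topologized by $\widehat M=\{\widehat a: a\in M\}$ with $\widehat a(p)=p(a)$; this is a $D$-laminated MV-space. The functor $\Omega$ sends $(X,\tau)$ to the $D$-frame $\tau$ (pointwise operations: $\bigvee$, $\wedge$, $r*\alpha=r\odot\alpha$, $\cdot=\odot$, $+=\oplus$) and a continuous $f:X\to Y$ to the homomorphism $\tau_Y\to\tau_X$, $\alpha\mapsto\alpha\circ f$. The functor $\operatorname{pt}$ sends $M$ to $(\operatorname{pt}M,\widehat M)$ and a homomorphism $q:L\to M$ to the continuous map $\operatorname{pt}M\to\operatorname{pt}L$, $p\mapsto p\circ q$. For $x\in X$, $\mathbf x:\{\star\}\to X$ is the map $\star\mapsto x$, and $\Omega(\mathbf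 x):\Omega(X)\to[0,1]$ is $\alpha\mapsto\alpha(x)$. *)

theory Defs
  imports Complex_Main "HOL-Library.FuncSet" "HOL-Algebra.Complete_Lattice" "HOL-Algebra.Group"
begin

section \<open>The unit interval and its subquantales\<close>

definition luk_prod :: "real \<Rightarrow> real \<Rightarrow> real" (infixl \<open>\<odot>\<close> 70)
  where "a \<odot> b = max 0 (a + b - 1)"

definition luk_sum :: "real \<Rightarrow> real \<Rightarrow> real" (infixl \<open>\<oplus>\<close> 65)
  where "a \<oplus> b = min 1 (a + b)"

text \<open>Supremum in \<open>[0,1]\<close>. Inserting \<open>0\<close> only matters for the empty set, whose supremum in
  \<open>[0,1]\<close> is \<open>0\<close>, whereas \<^term>\<open>Sup {} :: real\<close> is unspecified.\<close>

definition usup :: "real set \<Rightarrow> real"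
  where "usup S = Sup (insert 0 S)"

definition subquantale :: "real set \<Rightarrow> bool"
  where "subquantale D \<longleftrightarrow>
    D \<subseteq> {0..1} \<and> (\<forall>S. S \<subseteq> D \<longrightarrow> usup S \<in> D) \<and> (\<forall>r\<in>D. \<forall>s\<in>D. r \<odot> s \<in> D)"


section \<open>The category \<open>Top(D)\<close>\<close>

text \<open>The underlying set of a space is a subset of a type, and elements of \<open>[0,1]\<^sup>X\<close>
  are extensional functions (\<open>undefined\<close> outside of \<open>X\<close>), so that equality of
  functions is equality on \<open>X\<close>. Morphisms of both categories are treated in the same way; they are
  composed by \<^const>\<open>compose\<close> and identities are restrictions of the identity.\<close>

record 'x mv_space =
  pts :: "'x set"
  opens :: "('x \<Rightarrow> real) set"

definition laminated_mv_space :: "real set \<Rightarrow> 'x mv_space \<Rightarrow> bool"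
  where "laminated_mv_space D X \<longleftrightarrow>
    opens X \<subseteq> (pts X \<rightarrow>\<^sub>E {0..1}) \<and>
    (\<lambda>x\<in>pts X. 1) \<in> opens X \<and>
    (\<forall>S. S \<subseteq> opens X \<longrightarrow> (\<lambda>x\<in>pts X. usup ((\<lambda>\<alpha>. \<alpha> x) ` S)) \<in> opens X) \<and>
    (\<forall>r\<in>D. \<forall>\<alpha>\<in>opens X. (\<lambda>x\<in>pts X. r \<odot> \<alpha> x) \<in> opens X) \<and>
    (\<forall>\<alpha>\<in>opens X. \<forall>\<beta>\<in>opens X. (\<lambda>x\<in>pts X. \<alpha> x \<odot> \<beta> x) \<in> opens X) \<and>
    (\<forall>\<alpha>\<in>opens X. \<forall>\<beta>\<in>opens X. (\<lambda>x\<in>pts X. \<alpha> x \<oplus> \<beta> x) \<in> opens X) \<and>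
    (\<forall>\<alpha>\<in>opens X. \<forall>\<beta>\<in>opens X. (\<lambda>x\<in>pts X. min (\<alpha> x) (\<beta> x)) \<in> opens X)"

definition Top_hom :: "'x mv_space \<Rightarrow> 'y mv_space \<Rightarrow> ('x \<Rightarrow> 'y) set"
  where "Top_hom X Y =
    {f \<in> pts X \<rightarrow>\<^sub>E pts Y. \<forall>\<alpha>\<in>opens Y. compose (pts X) \<alpha> f \<in> opens X}"

lemma Top_id: "laminated_mv_space D X \<Longrightarrow> (\<lambda>x\<in>pts X. x) \<in> Top_hom X X"
proof -
  assume "laminated_mv_space D X"
  then have "opens X \<subseteq> (pts X \<rightarrow>\<^sub>E {0..1})" by (simp add: laminated_mv_space_def)
  then have "compose (pts X) \<alpha> (\<lambda>x\<in>pts X. x) = \<alpha>" if "\<alpha> \<in> opens X" for \<alpha>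
    using that by (auto simp: compose_def fun_eq_iff PiE_def extensional_def)
  then show ?thesis by (auto simp: Top_hom_def)
qed

lemma Top_comp: "f \<in> Top_hom X Y \<Longrightarrow> g \<in> Top_hom Y Z \<Longrightarrow> compose (pts X) g f \<in> Top_hom X Z"
proof -
  assume f: "f \<in> Top_hom X Y" and g: "g \<in> Top_hom Y Z"
  have "compose (pts X) \<alpha> (compose (pts X) g f) = compose (pts X) (compose (pts Y) \<alpha> g) f" for \<alpha>
    using f by (auto simp: Top_hom_def compose_def fun_eq_iff)
  then have "\<forall>\<alpha>\<in>opens Z. compose (pts X) \<alpha> (compose (pts X) g f) \<in> opens X" using f g unfolding Top_hom_def by (metis (mono_tags, lifting) mem_Collect_eq)
  moreover have "compose (pts X) g f \<in> pts X \<rightarrow>\<^sub>E pts Z" using f g by (auto simp: Top_hom_def compose_def)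
  ultimately show ?thesis by (simp add: Top_hom_def)
qed


section \<open>The category \<open>Frm(D)\<close>\<close>

record 'm quantale_struct = "'m gorder" +
  qprod :: "'m \<Rightarrow> 'm \<Rightarrow> 'm" (infixl \<open>\<cdot>\<index>\<close> 70)

record 'm D_algebra_struct = "'m quantale_struct" +
  act :: "real \<Rightarrow> 'm \<Rightarrow> 'm" (infixr \<open>\<star>\<index>\<close> 75)

record 'm D_frame_struct = "'m D_algebra_struct" +
  fadd :: "'m \<Rightarrow> 'm \<Rightarrow> 'm" (infixl \<open>\<^bold>+\<index>\<close> 65)
  fzero :: "'m" (\<open>\<^bold>0\<index>\<close>)

locale quantale = complete_lattice M
  for M :: "('m, 'b) quantale_struct_scheme" (structure) +
  assumes prod_closed: "\<lbrakk>a \<in> carrier M; b \<in> carrier M\<rbrakk> \<Longrightarrow> a \<cdot> b \<in> carrier M"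
    and prod_assoc: "\<lbrakk>a \<in> carrier M; b \<in> carrier M; c \<in> carrier M\<rbrakk> \<Longrightarrow>
      (a \<cdot> b) \<cdot> c = a \<cdot> (b \<cdot> c)"
    and prod_Sup: "\<lbrakk>a \<in> carrier M; S \<subseteq> carrier M\<rbrakk> \<Longrightarrow> a \<cdot> \<Squnion>S = \<Squnion>((\<lambda>s. a \<cdot> s) ` S)"
    and Sup_prod: "\<lbrakk>a \<in> carrier M; S \<subseteq> carrier M\<rbrakk> \<Longrightarrow> (\<Squnion>S) \<cdot> a = \<Squnion>((\<lambda>s. s \<cdot> a) ` S)"

text \<open>A subquantale \<open>D\<close> of \<open>[0,1]\<close> need not contain the unit \<open>1\<close>; the unit law of the action is
  required exactly when \<open>1 \<in> D\<close>.\<close>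

locale D_algebra = quantale M
  for D :: "real set" and M :: "('m, 'b) D_algebra_struct_scheme" (structure) +
  assumes act_closed: "\<lbrakk>r \<in> D; a \<in> carrier M\<rbrakk> \<Longrightarrow> r \<star> a \<in> carrier M"
    and act_unit: "\<lbrakk>1 \<in> D; a \<in> carrier M\<rbrakk> \<Longrightarrow> 1 \<star> a = a"
    and act_act: "\<lbrakk>q \<in> D; r \<in> D; a \<in> carrier M\<rbrakk> \<Longrightarrow> (q \<odot> r) \<star> a = q \<star> (r \<star> a)"
    and act_Sup: "\<lbrakk>r \<in> D; S \<subseteq> carrier M\<rbrakk> \<Longrightarrow> r \<star> \<Squnion>S = \<Squnion>((\<lambda>s. r \<star> s) ` S)"
    and usup_act: "\<lbrakk>R \<subseteq> D; a \<in> carrier M\<rbrakk> \<Longrightarrow> usup R \<star> a = \<Squnion>((\<lambda>r. r \<star> a) ` R)"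
    and act_prod_left: "\<lbrakk>q \<in> D; a \<in> carrier M; b \<in> carrier M\<rbrakk> \<Longrightarrow> q \<star> (a \<cdot> b) = (q \<star> a) \<cdot> b"
    and act_prod_right: "\<lbrakk>q \<in> D; a \<in> carrier M; b \<in> carrier M\<rbrakk> \<Longrightarrow> q \<star> (a \<cdot> b) = a \<cdot> (q \<star> b)"

text \<open>The constant \<open>1\<close> of a \<open>D\<close>-frame is the top element of the underlying frame.\<close>

locale D_frame = D_algebra D M
  for D :: "real set" and M :: "('m, 'b) D_frame_struct_scheme" (structure) +
  assumes meet_Sup: "\<lbrakk>a \<in> carrier M; S \<subseteq> carrier M\<rbrakk> \<Longrightarrow> a \<sqinter> \<Squnion>S = \<Squnion>((\<lambda>s. a \<sqinter> s) ` S)"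
    and add_comm_monoid: "comm_monoid \<lparr>carrier = carrier M, mult = fadd M, one = fzero M\<rparr>"
    and add_meet: "\<lbrakk>a \<in> carrier M; b \<in> carrier M; c \<in> carrier M\<rbrakk> \<Longrightarrow>
      a \<^bold>+ (b \<sqinter> c) = (a \<^bold>+ b) \<sqinter> (a \<^bold>+ c)"

definition Frm_hom :: "real set \<Rightarrow> 'l D_frame_struct \<Rightarrow> 'm D_frame_struct \<Rightarrow> ('l \<Rightarrow> 'm) set"
  where "Frm_hom D L M =
    {q \<in> carrier L \<rightarrow>\<^sub>E carrier M.
      q \<top>\<^bsub>L\<^esub> = \<top>\<^bsub>M\<^esub> \<and>
      (\<forall>S. S \<subseteq> carrier L \<longrightarrow> q (\<Squnion>\<^bsub>L\<^esub>S) = \<Squnion>\<^bsub>M\<^esub>(q ` S)) \<and>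
      (\<forall>r\<in>D. \<forall>a\<in>carrier L. q (r \<star>\<^bsub>L\<^esub> a) = r \<star>\<^bsub>M\<^esub> q a) \<and>
      (\<forall>a\<in>carrier L. \<forall>b\<in>carrier L. q (a \<cdot>\<^bsub>L\<^esub> b) = q a \<cdot>\<^bsub>M\<^esub> q b) \<and>
      (\<forall>a\<in>carrier L. \<forall>b\<in>carrier L. q (a \<^bold>+\<^bsub>L\<^esub> b) = q a \<^bold>+\<^bsub>M\<^esub> q b) \<and>
      (\<forall>a\<in>carrier L. \<forall>b\<in>carrier L. q (a \<sqinter>\<^bsub>L\<^esub> b) = q a \<sqinter>\<^bsub>M\<^esub> q b)}"

lemma Frm_id: assumes "D_frame D M" shows "(\<lambda>a\<in>carrier M. a) \<in> Frm_hom D M M"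
proof -
  interpret D_frame D M by fact
  interpret A: comm_monoid "\<lparr>carrier = carrier M, mult = fadd M, one = fzero M\<rparr>" by (rule add_comm_monoid)
  have *: "(\<lambda>a\<in>carrier M. a) ` S = S" if "S \<subseteq> carrier M" for S using that by (auto simp: image_def subset_iff)
  have **: "\<forall>S. S \<subseteq> carrier M \<longrightarrow> (\<lambda>a\<in>carrier M. a) (\<Squnion>\<^bsub>M\<^esub>S) = \<Squnion>\<^bsub>M\<^esub>((\<lambda>a\<in>carrier M. a) ` S)"
    by (intro allI impI, subst *) auto
  show ?thesis unfolding Frm_hom_def
    by (intro CollectI conjI **, use A.m_closed in \<open>simp_all add: act_closed prod_closed\<close>)
qed

lemma Frm_comp: assumes "D_frame D K" "q \<in> Frm_hom D K L" "s \<in> Frm_hom D L M"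
  shows "compose (carrier K) s q \<in> Frm_hom D K M"
proof -
  interpret D_frame D K by fact
  interpret A: comm_monoid "\<lparr>carrier = carrier K, mult = fadd K, one = fzero K\<rparr>" by (rule add_comm_monoid)
  have q: "q x \<in> carrier L" if "x \<in> carrier K" for x using assms(2) that by (auto simp: Frm_hom_def)
  then have qS: "q ` S \<subseteq> carrier L" if "S \<subseteq> carrier K" for S using that by auto
  have s: "s x \<in> carrier M" if "x \<in> carrier L" for x using assms(3) that by (auto simp: Frm_hom_def)
  have *: "(\<lambda>x\<in>carrier K. s (q x)) ` S = s ` q ` S" if "S \<subseteq> carrier K" for S
    using that by (auto simp: image_def subset_iff)
  have **: "\<forall>S. S \<subseteq> carrier K \<longrightarrow> (\<lambda>x\<in>carrier K. s (q x)) (\<Squnion>\<^bsub>K\<^esub>S) = \<Squnion>\<^bsub>M\<^esub>((\<lambda>x\<in>carrier K. s (q x)) ` S)"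
    by (intro allI impI, subst *) (use assms(2,3) qS in \<open>auto simp: Frm_hom_def\<close>)
  show ?thesis using assms(2,3) A.m_closed q s unfolding Frm_hom_def compose_def
    by (intro CollectI conjI **, use A.m_closed in \<open>simp_all add: act_closed prod_closed\<close>)
qed

definition unit_frame :: "real D_frame_struct"
  where "unit_frame =
    \<lparr>carrier = {0..1}, eq = (=), le = (\<le>), qprod = (\<odot>), act = (\<odot>), fadd = (\<oplus>), fzero = 0\<rparr>"


section \<open>The functors \<open>\<Omega>\<close> and \<open>pt\<close>, the unit and the counit\<close>

text \<open>The joins and the binary meets of \<open>\<Omega> X\<close> are determined by the pointwise order; since
  \<^term>\<open>opens X\<close> is closed under pointwise suprema and pointwise minima, they are the pointwise ones.\<close>

definition Omega :: "'x mv_space \<Rightarrow> ('x \<Rightarrow> real) D_frame_struct"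
  where "Omega X =
    \<lparr>carrier = opens X,
     eq = (=),
     le = (\<lambda>\<alpha> \<beta>. \<forall>x\<in>pts X. \<alpha> x \<le> \<beta> x),
     qprod = (\<lambda>\<alpha> \<beta>. \<lambda>x\<in>pts X. \<alpha> x \<odot> \<beta> x),
     act = (\<lambda>r \<alpha>. \<lambda>x\<in>pts X. r \<odot> \<alpha> x),
     fadd = (\<lambda>\<alpha> \<beta>. \<lambda>x\<in>pts X. \<alpha> x \<oplus> \<beta> x),
     fzero = (\<lambda>x\<in>pts X. 0)\<rparr>"

text \<open>For \<open>f : X \<rightarrow> Y\<close> this is the frame homomorphism \<open>\<Omega> Y \<rightarrow> \<Omega> X\<close>.\<close>

definition Omega_map ::
    "'x mv_space \<Rightarrow> 'y mv_space \<Rightarrow> ('x \<Rightarrow> 'y) \<Rightarrow> (('y \<Rightarrow> real) \<Rightarrow> ('x \<Rightarrow> real))"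
  where "Omega_map X Y f = (\<lambda>\<alpha>\<in>opens Y. compose (pts X) \<alpha> f)"

definition points :: "real set \<Rightarrow> 'm D_frame_struct \<Rightarrow> ('m \<Rightarrow> real) set"
  where "points D M = Frm_hom D M unit_frame"

definition hat :: "real set \<Rightarrow> 'm D_frame_struct \<Rightarrow> 'm \<Rightarrow> (('m \<Rightarrow> real) \<Rightarrow> real)"
  where "hat D M a = (\<lambda>p\<in>points D M. p a)"

definition pt :: "real set \<Rightarrow> 'm D_frame_struct \<Rightarrow> ('m \<Rightarrow> real) mv_space"
  where "pt D M = \<lparr>pts = points D M, opens = hat D M ` carrier M\<rparr>"

text \<open>For \<open>q : L \<rightarrow> M\<close> this is the continuous map \<open>pt M \<rightarrow> pt L\<close>.\<close>

definition pt_map ::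
    "real set \<Rightarrow> 'l D_frame_struct \<Rightarrow> 'm D_frame_struct \<Rightarrow> ('l \<Rightarrow> 'm) \<Rightarrow> (('m \<Rightarrow> real) \<Rightarrow> ('l \<Rightarrow> real))"
  where "pt_map D L M q = (\<lambda>p\<in>points D M. compose (carrier L) p q)"

definition eta :: "'x mv_space \<Rightarrow> 'x \<Rightarrow> (('x \<Rightarrow> real) \<Rightarrow> real)"
  where "eta X = (\<lambda>x\<in>pts X. \<lambda>\<alpha>\<in>opens X. \<alpha> x)"

definition eps :: "real set \<Rightarrow> 'm D_frame_struct \<Rightarrow> 'm \<Rightarrow> (('m \<Rightarrow> real) \<Rightarrow> real)"
  where "eps D M = (\<lambda>a\<in>carrier M. hat D M a)"

end

(* A homomorphism into Omega X is the same as a family of points indexed by X: all operations of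
   Omega X are pointwise, so q is a homomorphism iff a \<mapsto> q a x is a point for every x.
   Exchanging the two arguments of q therefore gives the bijection between homomorphisms
   M \<rightarrow> Omega X and continuous maps X \<rightarrow> pt M; the unit is the transpose of the identity of Omega X
   and the counit that of the identity of pt M. *)
theory Submission
  imports Defs
begin

section \<open>Suprema and the truncated operations of the unit interval\<close>

lemma usup_bounds:
  assumes "S \<subseteq> {0..1}"
  shows usup_upper: "s \<in> S \<Longrightarrow> s \<le> usup S"
    and usup_le_iff: "usup S \<le> u \<longleftrightarrow> 0 \<le> u \<and> (\<forall>s\<in>S. s \<le> u)"
    and usup_mem: "usup S \<in> {0..1}"
proof -
  have bdd: "bdd_above (insert 0 S)"
    using assms by (auto intro!: bdd_aboveI[of _ 1])
  show "s \<in> S \<Longrightarrow> s \<le> usup S"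
    using bdd by (simp add: usup_def cSup_upper)
  show iff: "usup S \<le> u \<longleftrightarrow> 0 \<le> u \<and> (\<forall>s\<in>S. s \<le> u)" for u
    using bdd unfolding usup_def by (subst cSup_le_iff) auto
  have "0 \<le> usup S"
    unfolding usup_def using bdd by (simp add: cSup_upper)
  moreover have "usup S \<le> 1"
    using assms by (auto simp: iff)
  ultimately show "usup S \<in> {0..1}"
    by simp
qed

text \<open>Monotone continuous functions preserve suprema of nonempty bounded sets. The set here is
  \<open>insert 0 S\<close>, and \<open>f 0 = 0\<close> brings the image back to the form of
  \<open>usup\<close>, so empty \<open>S\<close> is covered too. Distributivity of \<odot> and
  \<open>min\<close> over joins are instances.\<close>

lemma mono_continuous_usup:
  assumes "mono f" "continuous_on UNIV f" "f 0 = (0::real)" "S \<subseteq> {0..1}"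
  shows "f (usup S) = usup (f ` S)"
proof -
  have "f (Sup (insert 0 S)) = (SUP s\<in>insert 0 S. f s)"
  proof (rule continuous_at_Sup_mono[OF assms(1)])
    show "continuous (at_left (Sup (insert 0 S))) f"
      using assms(2) by (auto simp: continuous_on_eq_continuous_at intro: continuous_at_imp_continuous_at_within)
    show "bdd_above (insert 0 S)"
      using assms(4) by (auto intro!: bdd_aboveI[of _ 1])
  qed auto
  then show ?thesis
    by (simp add: usup_def assms(3))
qed

text \<open>The side condition \<open>f 0 = 0\<close> becomes r \<odot> 0 = 0, which is where r
  \<le> 1 enters; in \<open>min_usup\<close> it is 0 \<le> r instead.\<close>

lemma luk_prod_usup:
  assumes "r \<in> {0..1}" "S \<subseteq> {0..1}"
  shows "r \<odot> usup S = usup ((\<lambda>s. r \<odot> s) ` S)"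
  by (rule mono_continuous_usup)
    (use assms in \<open>auto simp: luk_prod_def mono_def intro!: continuous_intros\<close>)

lemma luk_prod_commute: "a \<odot> b = b \<odot> a"
  by (simp add: luk_prod_def add.commute)

lemma usup_luk_prod:
  assumes "r \<in> {0..1}" "S \<subseteq> {0..1}"
  shows "usup S \<odot> r = usup ((\<lambda>s. s \<odot> r) ` S)"
  using luk_prod_usup[OF assms] by (simp add: luk_prod_commute)

lemma min_usup:
  assumes "r \<in> {0..1}" "S \<subseteq> {0..1}"
  shows "min r (usup S) = usup ((\<lambda>s. min r s) ` S)"
  by (rule mono_continuous_usup)
    (use assms in \<open>auto simp: mono_def intro: continuous_intros min.mono\<close>)

text \<open>On [0,1] both sides collapse to \<open>max 0 (a + b + c - 2)\<close>: if the inner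
  product is cut off at 0, so is the outer one, because the third factor is at most 1.\<close>

lemma luk_prod_assoc:
  assumes "a \<in> {0..1}" "b \<in> {0..1}" "c \<in> {0..1}"
  shows "a \<odot> b \<odot> c = a \<odot> (b \<odot> c)"
  using assms by (auto simp: luk_prod_def max_def)

lemma luk_prod_left_commute:
  assumes "a \<in> {0..1}" "b \<in> {0..1}" "c \<in> {0..1}"
  shows "a \<odot> (b \<odot> c) = b \<odot> (a \<odot> c)"
  using assms by (auto simp: luk_prod_def max_def)

lemma luk_prod_one: "a \<in> {0..1} \<Longrightarrow> 1 \<odot> a = a"
  by (simp add: luk_prod_def)

lemma luk_sum_min: "a \<oplus> min b c = min (a \<oplus> b) (a \<oplus> c)"
  by (simp add: luk_sum_def min_def)

lemma luk_sum_commute: "a \<oplus> b = b \<oplus> a"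
  by (simp add: luk_sum_def add.commute)

lemma luk_sum_zero: "a \<in> {0..1} \<Longrightarrow> 0 \<oplus> a = a"
  by (simp add: luk_sum_def)

text \<open>Dually, both sides collapse to \<open>min 1 (a + b + c)\<close>, because the summands
  are nonnegative.\<close>

lemma luk_sum_assoc:
  assumes "a \<in> {0..1}" "b \<in> {0..1}" "c \<in> {0..1}"
  shows "a \<oplus> b \<oplus> c = a \<oplus> (b \<oplus> c)"
  using assms by (auto simp: luk_sum_def min_def)

text \<open>The join is a choice among least upper bounds; antisymmetry makes these unique, so any
  least upper bound computed by hand is the join. The next two lemmas serve the same purpose for
  meets and the top element.\<close>

lemma (in partial_order) Sup_eqI: "least L x (Upper L A) \<Longrightarrow> \<Squnion>A = x"
  unfolding sup_def by (rule some_equality) (auto intro: least_unique)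

lemma (in partial_order) Inf_eqI: "greatest L x (Lower L A) \<Longrightarrow> \<Sqinter>A = x"
  unfolding inf_def by (rule some_equality) (auto intro: greatest_unique)

lemma (in partial_order) Top_eqI: "greatest L x (carrier L) \<Longrightarrow> \<top> = x"
  unfolding top_def by (rule some_equality) (auto intro: greatest_unique)


section \<open>The unit interval as a frame\<close>

lemma partial_order_unit_frame: "partial_order unit_frame"
  by standard (auto simp: unit_frame_def)

lemma unit_frame_simps [simp]:
  "carrier unit_frame = {0..1}" "qprod unit_frame = (\<odot>)" "act unit_frame = (\<odot>)"
  "fadd unit_frame = (\<oplus>)"
  by (simp_all add: unit_frame_def)

lemma unit_frame_Sup:
  assumes "S \<subseteq> {0..1}"
  shows "\<Squnion>\<^bsub>unit_frame\<^esub>S = usup S"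
proof (rule partial_order.Sup_eqI[OF partial_order_unit_frame], rule least_UpperI)
  show "usup S \<in> carrier unit_frame"
    using usup_mem[OF assms] by simp
  \<comment> \<open>Upper bounds are taken in the carrier, so 0 \<le> y, as the 0 inserted by
    \<open>usup\<close> requires.\<close>
  fix y assume "y \<in> Upper unit_frame S"
  then show "usup S \<sqsubseteq>\<^bsub>unit_frame\<^esub> y"
    using assms by (auto simp: usup_le_iff Upper_def unit_frame_def)
qed (use assms in \<open>auto simp: unit_frame_def usup_upper\<close>)

lemma unit_frame_meet:
  assumes "a \<in> {0..1}" "b \<in> {0..1}"
  shows "a \<sqinter>\<^bsub>unit_frame\<^esub> b = min a b"
  unfolding meet_def
  by (rule partial_order.Inf_eqI[OF partial_order_unit_frame], rule greatest_LowerI)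
    (use assms in \<open>auto simp: unit_frame_def Lower_def\<close>)

lemma unit_frame_top: "\<top>\<^bsub>unit_frame\<^esub> = 1"
  by (rule partial_order.Top_eqI[OF partial_order_unit_frame])
    (auto simp: greatest_def unit_frame_def)

text \<open>Replaces the abstract join, meet and top of \<open>unit_frame\<close> by
  \<open>usup\<close>, \<open>min\<close> and 1. The replacements are justified for values in [0,1],
  hence the case distinction; outside that function space both sides fail.\<close>

lemma points_iff:
  assumes "D_frame D M"
  shows "p \<in> points D M \<longleftrightarrow> p \<in> carrier M \<rightarrow>\<^sub>E {0..1} \<and>
    p \<top>\<^bsub>M\<^esub> = 1 \<and>
    (\<forall>S. S \<subseteq> carrier M \<longrightarrow> p (\<Squnion>\<^bsub>M\<^esub>S) = usup (p ` S)) \<and>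
    (\<forall>r\<in>D. \<forall>a\<in>carrier M. p (r \<star>\<^bsub>M\<^esub> a) = r \<odot> p a) \<and>
    (\<forall>a\<in>carrier M. \<forall>b\<in>carrier M. p (a \<cdot>\<^bsub>M\<^esub> b) = p a \<odot> p b) \<and>
    (\<forall>a\<in>carrier M. \<forall>b\<in>carrier M. p (a \<^bold>+\<^bsub>M\<^esub> b) = p a \<oplus> p b) \<and>
    (\<forall>a\<in>carrier M. \<forall>b\<in>carrier M. p (a \<sqinter>\<^bsub>M\<^esub> b) = min (p a) (p b))"
proof (cases "p \<in> carrier M \<rightarrow>\<^sub>E {0..1}")
  case True
  then have mem: "p a \<in> {0..1}" if "a \<in> carrier M" for a
    using that by auto
  then have Sup: "\<Squnion>\<^bsub>unit_frame\<^esub>(p ` S) = usup (p ` S)" if "S \<subseteq> carrier M" for S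
    using that by (intro unit_frame_Sup) auto
  have meet: "p a \<sqinter>\<^bsub>unit_frame\<^esub> p b = min (p a) (p b)" if "a \<in> carrier M" "b \<in> carrier M" for a b
    using that by (intro unit_frame_meet mem)
  show ?thesis
    unfolding points_def Frm_hom_def
    using True by (simp add: Sup meet unit_frame_top)
next
  case False
  then show ?thesis
    by (auto simp: points_def Frm_hom_def)
qed


section \<open>The frame of opens\<close>

lemma Omega_simps [simp]:
  "carrier (Omega X) = opens X"
  "\<alpha> \<sqsubseteq>\<^bsub>Omega X\<^esub> \<beta> \<longleftrightarrow> (\<forall>x\<in>pts X. \<alpha> x \<le> \<beta> x)"
  "\<alpha> \<cdot>\<^bsub>Omega X\<^esub> \<beta> = (\<lambda>x\<in>pts X. \<alpha> x \<odot> \<beta> x)"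
  "r \<star>\<^bsub>Omega X\<^esub> \<alpha> = (\<lambda>x\<in>pts X. r \<odot> \<alpha> x)"
  "\<alpha> \<^bold>+\<^bsub>Omega X\<^esub> \<beta> = (\<lambda>x\<in>pts X. \<alpha> x \<oplus> \<beta> x)"
  "\<^bold>0\<^bsub>Omega X\<^esub> = (\<lambda>x\<in>pts X. 0)"
  by (simp_all add: Omega_def)

locale mv_space_over =
  fixes D :: "real set" and X :: "'x mv_space"
  assumes D: "subquantale D" and X: "laminated_mv_space D X"
begin

lemma D_unit: "r \<in> D \<Longrightarrow> r \<in> {0..1}"
  using D by (auto simp: subquantale_def)

lemma opens_ext: "\<alpha> \<in> opens X \<Longrightarrow> \<alpha> \<in> extensional (pts X)"
  using X by (auto simp: laminated_mv_space_def PiE_def)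

lemma opens_unit: "\<alpha> \<in> opens X \<Longrightarrow> x \<in> pts X \<Longrightarrow> \<alpha> x \<in> {0..1}"
  using X unfolding laminated_mv_space_def by blast

lemma opens_image_unit: "S \<subseteq> opens X \<Longrightarrow> x \<in> pts X \<Longrightarrow> (\<lambda>\<alpha>. \<alpha> x) ` S \<subseteq> {0..1}"
  using opens_unit by blast

lemma opens_eqI:
  "\<alpha> \<in> opens X \<Longrightarrow> \<beta> \<in> opens X \<Longrightarrow> (\<And>x. x \<in> pts X \<Longrightarrow> \<alpha> x = \<beta> x) \<Longrightarrow> \<alpha> = \<beta>"
  by (rule extensionalityI[OF opens_ext opens_ext])

lemma opens_closed:
  shows opens_one: "(\<lambda>x\<in>pts X. 1) \<in> opens X"
    and opens_usup: "S \<subseteq> opens X \<Longrightarrow> (\<lambda>x\<in>pts X. usup ((\<lambda>\<alpha>. \<alpha> x) ` S)) \<in> opens X"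
    and opens_act: "r \<in> D \<Longrightarrow> \<alpha> \<in> opens X \<Longrightarrow> (\<lambda>x\<in>pts X. r \<odot> \<alpha> x) \<in> opens X"
    and opens_prod: "\<alpha> \<in> opens X \<Longrightarrow> \<beta> \<in> opens X \<Longrightarrow> (\<lambda>x\<in>pts X. \<alpha> x \<odot> \<beta> x) \<in> opens X"
    and opens_sum: "\<alpha> \<in> opens X \<Longrightarrow> \<beta> \<in> opens X \<Longrightarrow> (\<lambda>x\<in>pts X. \<alpha> x \<oplus> \<beta> x) \<in> opens X"
    and opens_min: "\<alpha> \<in> opens X \<Longrightarrow> \<beta> \<in> opens X \<Longrightarrow> (\<lambda>x\<in>pts X. min (\<alpha> x) (\<beta> x)) \<in> opens X"
  using X unfolding laminated_mv_space_def by auto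

text \<open>This is the join of the empty family, since \<open>usup {} = 0\<close>.\<close>

lemma opens_zero: "(\<lambda>x\<in>pts X. 0) \<in> opens X"
  using opens_usup[of "{}"] by (simp add: usup_def)

text \<open>Antisymmetry rests on extensionality: opens that agree on all points of the space are
  equal as functions.\<close>

lemma partial_order_Omega: "partial_order (Omega X)"
proof
  fix \<alpha> \<beta> assume "\<alpha> \<sqsubseteq>\<^bsub>Omega X\<^esub> \<beta>" "\<beta> \<sqsubseteq>\<^bsub>Omega X\<^esub> \<alpha>" "\<alpha> \<in> carrier (Omega X)" "\<beta> \<in> carrier (Omega X)"
  then have "\<alpha> = \<beta>"
    by (intro opens_eqI) (auto intro: order_antisym)
  then show "\<alpha> .=\<^bsub>Omega X\<^esub> \<beta>"
    by (simp add: Omega_def)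
qed (auto simp: Omega_def intro: order_trans)

lemma Omega_least:
  assumes S: "S \<subseteq> opens X"
  shows "least (Omega X) (\<lambda>x\<in>pts X. usup ((\<lambda>\<alpha>. \<alpha> x) ` S)) (Upper (Omega X) S)"
proof (rule least_UpperI)
  fix \<beta> assume "\<beta> \<in> Upper (Omega X) S"
  then have "\<beta> \<in> opens X" "\<forall>\<alpha>\<in>S. \<forall>x\<in>pts X. \<alpha> x \<le> \<beta> x"
    using S by (auto simp: Upper_def)
  then show "(\<lambda>x\<in>pts X. usup ((\<lambda>\<alpha>. \<alpha> x) ` S)) \<sqsubseteq>\<^bsub>Omega X\<^esub> \<beta>"
    using opens_unit by (auto simp: usup_le_iff[OF opens_image_unit[OF S]])
qed (use S in \<open>auto simp: opens_usup usup_upper[OF opens_image_unit[OF S]]\<close>)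

lemma Omega_Sup: "S \<subseteq> opens X \<Longrightarrow> \<Squnion>\<^bsub>Omega X\<^esub>S = (\<lambda>x\<in>pts X. usup ((\<lambda>\<alpha>. \<alpha> x) ` S))"
  by (rule partial_order.Sup_eqI[OF partial_order_Omega Omega_least])

lemma Omega_meet:
  "\<alpha> \<in> opens X \<Longrightarrow> \<beta> \<in> opens X \<Longrightarrow> \<alpha> \<sqinter>\<^bsub>Omega X\<^esub> \<beta> = (\<lambda>x\<in>pts X. min (\<alpha> x) (\<beta> x))"
  unfolding meet_def
  by (rule partial_order.Inf_eqI[OF partial_order_Omega], rule greatest_LowerI)
    (auto simp: Lower_def opens_min)

lemma Omega_top: "\<top>\<^bsub>Omega X\<^esub> = (\<lambda>x\<in>pts X. 1)"
  by (rule partial_order.Top_eqI[OF partial_order_Omega])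
    (use opens_unit in \<open>auto simp: greatest_def opens_one\<close>)

lemma complete_lattice_Omega: "complete_lattice (Omega X)"
proof (rule partial_order.complete_latticeI[OF partial_order_Omega])
  fix A assume A: "A \<subseteq> carrier (Omega X)"
  then show "\<exists>s. least (Omega X) s (Upper (Omega X) A)"
    using Omega_least by auto
  \<comment> \<open>Infinite meets need not be pointwise, as opens are closed under binary minima
    only; the meet of \<open>A\<close> is obtained as the join of its lower bounds.\<close>
  have "Lower (Omega X) A \<subseteq> opens X"
    by (auto simp: Lower_def)
  from Omega_least[OF this] obtain i
    where "least (Omega X) i (Upper (Omega X) (Lower (Omega X) A))" ..
  with A have "greatest (Omega X) i (Lower (Omega X) A)"
    unfolding least_def greatest_def Upper_def Lower_def by blast
  then show "\<exists>i. greatest (Omega X) i (Lower (Omega X) A)"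
    by blast
qed

text \<open>Reduces a distributive law in \<open>Omega X\<close> to the law in [0,1] at each point,
  which is the assumption on \<open>g\<close>.\<close>

lemma Omega_Sup_image:
  assumes S: "S \<subseteq> opens X" and F: "\<And>\<alpha>. \<alpha> \<in> S \<Longrightarrow> F \<alpha> \<in> opens X"
    and g: "\<And>x. x \<in> pts X \<Longrightarrow> g x = usup ((\<lambda>\<alpha>. F \<alpha> x) ` S)"
  shows "restrict g (pts X) = \<Squnion>\<^bsub>Omega X\<^esub>(F ` S)"
  using S F g by (subst Omega_Sup) (auto simp: image_image cong: restrict_cong)

text \<open>Since the operations and joins are pointwise, every axiom is inherited from the
  corresponding law of [0,1].\<close>

lemma D_frame_Omega: "D_frame D (Omega X)"
proof (intro D_frame.intro D_algebra.intro quantale.intro quantale_axioms.intro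
    D_algebra_axioms.intro D_frame_axioms.intro complete_lattice_Omega)
  show "comm_monoid \<lparr>carrier = carrier (Omega X), mult = fadd (Omega X), one = fzero (Omega X)\<rparr>"
    by (rule comm_monoidI; insert opens_unit; auto simp: opens_sum opens_zero luk_sum_assoc luk_sum_zero
        extensional_restrict[OF opens_ext] cong: restrict_cong; simp add: luk_sum_commute)
next
  fix \<alpha> S assume "\<alpha> \<in> carrier (Omega X)" and "S \<subseteq> carrier (Omega X)"
  then have \<alpha>: "\<alpha> \<in> opens X" and S: "S \<subseteq> opens X"
    by auto
  have mem: "\<alpha> x \<in> {0..1}" "(\<lambda>\<beta>. \<beta> x) ` S \<subseteq> {0..1}" if "x \<in> pts X" for x
    using that opens_unit[OF \<alpha>] opens_image_unit[OF S] by auto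
  note usup = luk_prod_usup[OF mem, unfolded image_image] usup_luk_prod[OF mem, unfolded image_image]
    min_usup[OF mem, unfolded image_image]
  show "\<alpha> \<cdot>\<^bsub>Omega X\<^esub> \<Squnion>\<^bsub>Omega X\<^esub>S = \<Squnion>\<^bsub>Omega X\<^esub>((\<lambda>\<beta>. \<alpha> \<cdot>\<^bsub>Omega X\<^esub> \<beta>) ` S)"
    unfolding Omega_simps
    by (rule Omega_Sup_image) (use \<alpha> S in \<open>auto simp: Omega_Sup opens_prod usup\<close>)
  show "\<Squnion>\<^bsub>Omega X\<^esub>S \<cdot>\<^bsub>Omega X\<^esub> \<alpha> = \<Squnion>\<^bsub>Omega X\<^esub>((\<lambda>\<beta>. \<beta> \<cdot>\<^bsub>Omega X\<^esub> \<alpha>) ` S)"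
    unfolding Omega_simps
    by (rule Omega_Sup_image) (use \<alpha> S in \<open>auto simp: Omega_Sup opens_prod usup\<close>)
  have "\<alpha> \<sqinter>\<^bsub>Omega X\<^esub> \<Squnion>\<^bsub>Omega X\<^esub>S = (\<lambda>x\<in>pts X. min (\<alpha> x) ((\<Squnion>\<^bsub>Omega X\<^esub>S) x))"
    using \<alpha> S by (simp add: Omega_meet Omega_Sup opens_usup)
  also have "\<dots> = \<Squnion>\<^bsub>Omega X\<^esub>((\<lambda>\<beta>. \<alpha> \<sqinter>\<^bsub>Omega X\<^esub> \<beta>) ` S)"
  proof (rule Omega_Sup_image[OF S])
    fix x assume x: "x \<in> pts X"
    \<comment> \<open>\<open>Omega_meet\<close> speaks of opens only, so the members of the family
      are rewritten one by one, using that they lie in \<open>S\<close>.\<close>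
    have "(\<lambda>\<beta>. (\<alpha> \<sqinter>\<^bsub>Omega X\<^esub> \<beta>) x) ` S = (\<lambda>\<beta>. min (\<alpha> x) (\<beta> x)) ` S"
      using \<alpha> S x by (intro image_cong) (auto simp: Omega_meet)
    then show "min (\<alpha> x) ((\<Squnion>\<^bsub>Omega X\<^esub>S) x) = usup ((\<lambda>\<beta>. (\<alpha> \<sqinter>\<^bsub>Omega X\<^esub> \<beta>) x) ` S)"
      using S x by (simp add: Omega_Sup usup)
  qed (use \<alpha> S in \<open>auto simp: Omega_meet opens_min subset_iff\<close>)
  finally show "\<alpha> \<sqinter>\<^bsub>Omega X\<^esub> \<Squnion>\<^bsub>Omega X\<^esub>S = \<Squnion>\<^bsub>Omega X\<^esub>((\<lambda>\<beta>. \<alpha> \<sqinter>\<^bsub>Omega X\<^esub> \<beta>) ` S)" .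
next
  fix r S assume r: "r \<in> D" and "S \<subseteq> carrier (Omega X)"
  then have S: "S \<subseteq> opens X"
    by auto
  show "r \<star>\<^bsub>Omega X\<^esub> \<Squnion>\<^bsub>Omega X\<^esub>S = \<Squnion>\<^bsub>Omega X\<^esub>((\<lambda>\<beta>. r \<star>\<^bsub>Omega X\<^esub> \<beta>) ` S)"
    unfolding Omega_simps
    by (rule Omega_Sup_image)
      (use r S in \<open>auto simp: Omega_Sup opens_act luk_prod_usup[OF D_unit opens_image_unit[OF S]] image_image\<close>)
next
  fix R \<alpha> assume R: "R \<subseteq> D" and "\<alpha> \<in> carrier (Omega X)"
  then have \<alpha>: "\<alpha> \<in> opens X"
    by simp
  have R1: "R \<subseteq> {0..1}"
    using R D_unit by auto
  show "usup R \<star>\<^bsub>Omega X\<^esub> \<alpha> = \<Squnion>\<^bsub>Omega X\<^esub>((\<lambda>r. r \<star>\<^bsub>Omega X\<^esub> \<alpha>) ` R)"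
    using \<alpha> R by (subst Omega_Sup)
      (auto simp: opens_act image_image usup_luk_prod[OF opens_unit[OF \<alpha>] R1] cong: restrict_cong)
qed (use opens_unit D_unit in
  \<open>auto simp: opens_prod opens_act opens_sum opens_min Omega_meet luk_prod_assoc
    luk_prod_left_commute luk_prod_one luk_sum_min extensional_restrict[OF opens_ext]
    cong: restrict_cong\<close>)

text \<open>Turns the equations required of a homomorphism into \<open>Omega X\<close> into families
  of equations between reals.\<close>

lemma opens_eq_iff:
  "\<alpha> \<in> opens X \<Longrightarrow> \<beta> \<in> opens X \<Longrightarrow> \<alpha> = \<beta> \<longleftrightarrow> (\<forall>x\<in>pts X. \<alpha> x = \<beta> x)"
  using opens_eqI by blast

end

lemma (in D_frame) add_closed: "a \<in> carrier M \<Longrightarrow> b \<in> carrier M \<Longrightarrow> a \<^bold>+ b \<in> carrier M"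
  using monoid.m_closed[OF comm_monoid.axioms(1)[OF add_comm_monoid]] by simp


section \<open>Homomorphisms into a frame of opens as families of points\<close>

text \<open>Each preservation condition equates two opens, so it holds iff it holds at every point;
  moving the quantifier over points to the front leaves the conditions of
  \<open>points_iff\<close>.\<close>

lemma (in mv_space_over) Frm_hom_Omega_iff:
  assumes "D_frame D M"
  shows "q \<in> Frm_hom D M (Omega X) \<longleftrightarrow>
    q \<in> carrier M \<rightarrow>\<^sub>E opens X \<and> (\<forall>x\<in>pts X. (\<lambda>a\<in>carrier M. q a x) \<in> points D M)"
proof (cases "q \<in> carrier M \<rightarrow>\<^sub>E opens X")
  case True
  interpret M: D_frame D M by fact
  have q: "q a \<in> opens X" if "a \<in> carrier M" for a
    using True that by auto
  have qS: "q ` S \<subseteq> opens X" if "S \<subseteq> carrier M" for S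
    using q that by auto
  have top: "q \<top>\<^bsub>M\<^esub> = \<top>\<^bsub>Omega X\<^esub> \<longleftrightarrow> (\<forall>x\<in>pts X. q \<top>\<^bsub>M\<^esub> x = 1)"
    by (simp add: Omega_top opens_eq_iff q opens_one)
  \<comment> \<open>The restricted function in the image is kept so that this matches the join
    clause of \<open>point\<close> below.\<close>
  have Sup: "q (\<Squnion>\<^bsub>M\<^esub>S) = \<Squnion>\<^bsub>Omega X\<^esub>(q ` S) \<longleftrightarrow>
      (\<forall>x\<in>pts X. q (\<Squnion>\<^bsub>M\<^esub>S) x = usup ((\<lambda>a\<in>carrier M. q a x) ` S))" if S: "S \<subseteq> carrier M" for S
  proof -
    have "(\<lambda>a\<in>carrier M. q a x) ` S = (\<lambda>\<alpha>. \<alpha> x) ` q ` S" for x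
      unfolding image_image using S by (intro image_cong) auto
    then show ?thesis
      using S by (simp add: Omega_Sup qS opens_eq_iff q opens_usup)
  qed
  have act: "q (r \<star>\<^bsub>M\<^esub> a) = r \<star>\<^bsub>Omega X\<^esub> q a \<longleftrightarrow> (\<forall>x\<in>pts X. q (r \<star>\<^bsub>M\<^esub> a) x = r \<odot> q a x)"
    if "r \<in> D" "a \<in> carrier M" for r a
    using that by (simp add: opens_eq_iff q M.act_closed opens_act)
  have prod: "q (a \<cdot>\<^bsub>M\<^esub> b) = q a \<cdot>\<^bsub>Omega X\<^esub> q b \<longleftrightarrow> (\<forall>x\<in>pts X. q (a \<cdot>\<^bsub>M\<^esub> b) x = q a x \<odot> q b x)"
    if "a \<in> carrier M" "b \<in> carrier M" for a b
    using that by (simp add: opens_eq_iff q M.prod_closed opens_prod)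
  have add: "q (a \<^bold>+\<^bsub>M\<^esub> b) = q a \<^bold>+\<^bsub>Omega X\<^esub> q b \<longleftrightarrow> (\<forall>x\<in>pts X. q (a \<^bold>+\<^bsub>M\<^esub> b) x = q a x \<oplus> q b x)"
    if "a \<in> carrier M" "b \<in> carrier M" for a b
    using that by (simp add: opens_eq_iff q M.add_closed opens_sum)
  have meet: "q (a \<sqinter>\<^bsub>M\<^esub> b) = q a \<sqinter>\<^bsub>Omega X\<^esub> q b \<longleftrightarrow> (\<forall>x\<in>pts X. q (a \<sqinter>\<^bsub>M\<^esub> b) x = min (q a x) (q b x))"
    if "a \<in> carrier M" "b \<in> carrier M" for a b
    using that by (simp add: Omega_meet opens_eq_iff q opens_min)
  have unit: "(\<lambda>a\<in>carrier M. q a x) \<in> carrier M \<rightarrow>\<^sub>E {0..1}" if "x \<in> pts X" for x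
    using opens_unit[OF q that] by auto
  \<comment> \<open>Closure of \<open>carrier M\<close> under the operations removes the restriction
    everywhere except in that image.\<close>
  have point: "(\<lambda>a\<in>carrier M. q a x) \<in> points D M \<longleftrightarrow>
    q \<top>\<^bsub>M\<^esub> x = 1 \<and>
    (\<forall>S. S \<subseteq> carrier M \<longrightarrow> q (\<Squnion>\<^bsub>M\<^esub>S) x = usup ((\<lambda>a\<in>carrier M. q a x) ` S)) \<and>
    (\<forall>r\<in>D. \<forall>a\<in>carrier M. q (r \<star>\<^bsub>M\<^esub> a) x = r \<odot> q a x) \<and>
    (\<forall>a\<in>carrier M. \<forall>b\<in>carrier M. q (a \<cdot>\<^bsub>M\<^esub> b) x = q a x \<odot> q b x) \<and>
    (\<forall>a\<in>carrier M. \<forall>b\<in>carrier M. q (a \<^bold>+\<^bsub>M\<^esub> b) x = q a x \<oplus> q b x) \<and>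
    (\<forall>a\<in>carrier M. \<forall>b\<in>carrier M. q (a \<sqinter>\<^bsub>M\<^esub> b) x = min (q a x) (q b x))" if "x \<in> pts X" for x
    unfolding points_iff[OF assms]
    using unit[OF that] by (simp add: M.act_closed M.prod_closed M.add_closed)
  show ?thesis
    unfolding Frm_hom_def
    using True
    by (simp add: top Sup act prod add meet point del: Omega_simps(2-) cong: ball_cong_simp) blast
next
  case False
  then show ?thesis
    by (auto simp: Frm_hom_def)
qed

section \<open>The space of points of a frame\<close>

lemma pt_simps [simp]: "pts (pt D M) = points D M" "opens (pt D M) = hat D M ` carrier M"
  by (simp_all add: pt_def)

text \<open>The opens of the space of points are the functions \<open>hat D M a\<close>, and
  composing one with \<open>f\<close> yields x \<mapsto> f x a. This is the counterpart of
  \<open>Frm_hom_Omega_iff\<close> with the two arguments exchanged.\<close>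

lemma Top_hom_pt_iff:
  "f \<in> Top_hom X (pt D M) \<longleftrightarrow>
    f \<in> pts X \<rightarrow>\<^sub>E points D M \<and> (\<forall>a\<in>carrier M. (\<lambda>x\<in>pts X. f x a) \<in> opens X)"
proof (cases "f \<in> pts X \<rightarrow>\<^sub>E points D M")
  case True
  then have "compose (pts X) (hat D M a) f = (\<lambda>x\<in>pts X. f x a)" for a
    by (auto simp: compose_def hat_def fun_eq_iff)
  with True show ?thesis
    by (simp add: Top_hom_def)
next
  case False
  then show ?thesis
    by (simp add: Top_hom_def)
qed

lemma points_extensional: "p \<in> points D M \<Longrightarrow> p \<in> extensional (carrier M)"
  by (auto simp: points_def Frm_hom_def PiE_def)

text \<open>Points preserve the operations of \<open>M\<close>, so a pointwise operation applied to
  hats is the hat of the same operation applied in \<open>M\<close>.\<close>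

lemma laminated_mv_space_pt:
  assumes "D_frame D M"
  shows "laminated_mv_space D (pt D M)"
proof -
  interpret M: D_frame D M by fact
  note point = points_iff[OF assms, THEN iffD1]
  have "hat D M a \<in> points D M \<rightarrow>\<^sub>E {0..1}" if "a \<in> carrier M" for a
    using that point by (fastforce simp: hat_def)
  moreover have "(\<lambda>p\<in>points D M. 1) = hat D M \<top>\<^bsub>M\<^esub>"
    using point by (auto simp: hat_def)
  moreover have "(\<lambda>p\<in>points D M. usup ((\<lambda>\<alpha>. \<alpha> p) ` S)) \<in> hat D M ` carrier M"
    if "S \<subseteq> hat D M ` carrier M" for S
  proof -
    \<comment> \<open>\<open>hat D M\<close> need not be injective; \<open>T\<close> is any set of
      representatives whose hats make up \<open>S\<close>.\<close>
    from that obtain T where T: "T \<subseteq> carrier M" "S = hat D M ` T"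
      by (auto simp: subset_image_iff)
    have "(\<lambda>p\<in>points D M. usup ((\<lambda>\<alpha>. \<alpha> p) ` S)) = hat D M (\<Squnion>\<^bsub>M\<^esub>T)"
      unfolding hat_def T(2) image_image using point T(1) by (intro restrict_ext) simp
    then show ?thesis
      using T(1) by auto
  qed
  moreover have "(\<lambda>p\<in>points D M. r \<odot> hat D M a p) = hat D M (r \<star>\<^bsub>M\<^esub> a)"
    if "r \<in> D" "a \<in> carrier M" for r a
    unfolding hat_def using point that by (intro restrict_ext) simp
  moreover have
    "(\<lambda>p\<in>points D M. hat D M a p \<odot> hat D M b p) = hat D M (a \<cdot>\<^bsub>M\<^esub> b)"
    "(\<lambda>p\<in>points D M. hat D M a p \<oplus> hat D M b p) = hat D M (a \<^bold>+\<^bsub>M\<^esub> b)"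
    "(\<lambda>p\<in>points D M. min (hat D M a p) (hat D M b p)) = hat D M (a \<sqinter>\<^bsub>M\<^esub> b)"
    if "a \<in> carrier M" "b \<in> carrier M" for a b
    unfolding hat_def using point that by (auto intro!: restrict_ext)
  ultimately show ?thesis
    unfolding laminated_mv_space_def pt_simps
    by (auto simp: M.act_closed M.prod_closed M.add_closed)
qed

section \<open>Transposition between homomorphisms and continuous maps\<close>

context mv_space_over
begin

lemma eta_points:
  assumes "x \<in> pts X"
  shows "eta X x \<in> points D (Omega X)"
proof -
  \<comment> \<open>The identity is a homomorphism into \<open>Omega X\<close>, and its component at
    \<open>x\<close> is evaluation at \<open>x\<close>.\<close>
  have "(\<lambda>\<alpha>\<in>opens X. \<alpha>) \<in> Frm_hom D (Omega X) (Omega X)"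
    using Frm_id[OF D_frame_Omega] by simp
  then have "(\<lambda>\<alpha>\<in>opens X. (\<lambda>\<alpha>\<in>opens X. \<alpha>) \<alpha> x) \<in> points D (Omega X)"
    using assms by (simp add: Frm_hom_Omega_iff[OF D_frame_Omega] del: restrict_apply)
  then show ?thesis
    using assms by (simp add: eta_def cong: restrict_cong)
qed

text \<open>Says that the hat of \<alpha> pulls back along the unit to \<alpha>. This gives both the
  continuity of the unit and the triangle identity for \<open>Omega X\<close>.\<close>

lemma eta_evaluation: "\<alpha> \<in> opens X \<Longrightarrow> (\<lambda>x\<in>pts X. eta X x \<alpha>) = \<alpha>"
  using opens_ext[of \<alpha>] by (auto simp: eta_def extensional_def)

lemma eta_Top_hom: "eta X \<in> Top_hom X (pt D (Omega X))"
  using eta_points by (auto simp: Top_hom_pt_iff eta_evaluation) (simp add: eta_def)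

text \<open>Evaluation at \<open>x\<close> composed with \<open>q\<close> is a \<mapsto> q a x, so
  the transpose formed with the unit is the exchange of arguments; \<open>transpose_map\<close> is
  the same for the counit.\<close>

lemma transpose_hom:
  assumes "q \<in> Frm_hom D M (Omega X)"
  shows "compose (pts X) (pt_map D M (Omega X) q) (eta X) = (\<lambda>x\<in>pts X. \<lambda>a\<in>carrier M. q a x)"
proof -
  have "q a \<in> opens X" if "a \<in> carrier M" for a
    using assms that by (auto simp: Frm_hom_def)
  then show ?thesis
    unfolding compose_def pt_map_def
    by (intro restrict_ext) (simp add: eta_points, auto simp: eta_def compose_def)
qed

lemma transpose_map:
  assumes "f \<in> Top_hom X (pt D M)"
  shows "compose (carrier M) (Omega_map X (pt D M) f) (eps D M) = (\<lambda>a\<in>carrier M. \<lambda>x\<in>pts X. f x a)"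
  using assms unfolding compose_def Omega_map_def eps_def Top_hom_pt_iff
  by (intro restrict_ext) (auto simp: hat_def fun_eq_iff)

text \<open>Opens are extensional, so restricting \<open>q a\<close> to the points changes nothing,
  and the two characterisations of homomorphisms and continuous maps then state the same conditions.
  In \<open>transpose_map_mem\<close> extensionality of points does this.\<close>

lemma transpose_hom_mem:
  assumes "D_frame D M" "q \<in> Frm_hom D M (Omega X)"
  shows "(\<lambda>x\<in>pts X. \<lambda>a\<in>carrier M. q a x) \<in> Top_hom X (pt D M)"
proof -
  have q: "q a \<in> opens X" if "a \<in> carrier M" for a
    using assms(2) that by (auto simp: Frm_hom_def)
  have "(\<lambda>x\<in>pts X. q a x) = q a" if "a \<in> carrier M" for a
    using opens_ext[OF q[OF that]] by (rule extensional_restrict)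
  then show ?thesis
    using assms(2) q unfolding Frm_hom_Omega_iff[OF assms(1)] Top_hom_pt_iff
    by (auto cong: restrict_cong)
qed

lemma transpose_map_mem:
  assumes "D_frame D M" "f \<in> Top_hom X (pt D M)"
  shows "(\<lambda>a\<in>carrier M. \<lambda>x\<in>pts X. f x a) \<in> Frm_hom D M (Omega X)"
proof -
  have "(\<lambda>a\<in>carrier M. f x a) = f x" if "x \<in> pts X" for x
    using assms(2) that by (intro extensional_restrict points_extensional) (auto simp: Top_hom_def)
  then show ?thesis
    using assms(2) unfolding Frm_hom_Omega_iff[OF assms(1)] Top_hom_pt_iff
    by (auto cong: restrict_cong)
qed

lemma transpose_transpose_hom:
  assumes "q \<in> Frm_hom D M (Omega X)"
  shows "(\<lambda>a\<in>carrier M. \<lambda>x\<in>pts X. (\<lambda>x\<in>pts X. \<lambda>a\<in>carrier M. q a x) x a) = q"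
proof -
  have "q \<in> carrier M \<rightarrow>\<^sub>E opens X"
    using assms by (simp add: Frm_hom_def)
  then show ?thesis
    using opens_ext by (fastforce simp: fun_eq_iff extensional_def PiE_def Pi_def)
qed

lemma transpose_transpose_map:
  assumes "f \<in> Top_hom X (pt D M)"
  shows "(\<lambda>x\<in>pts X. \<lambda>a\<in>carrier M. (\<lambda>a\<in>carrier M. \<lambda>x\<in>pts X. f x a) a x) = f"
proof -
  have "f \<in> pts X \<rightarrow>\<^sub>E points D M"
    using assms by (simp add: Top_hom_def)
  then show ?thesis
    using points_extensional by (fastforce simp: fun_eq_iff extensional_def PiE_def Pi_def)
qed

lemma bij_transpose_hom:
  assumes "D_frame D M"
  shows "bij_betw (\<lambda>q. compose (pts X) (pt_map D M (Omega X) q) (eta X))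
    (Frm_hom D M (Omega X)) (Top_hom X (pt D M))"
  by (rule bij_betw_byWitness[where f' = "\<lambda>f. compose (carrier M) (Omega_map X (pt D M) f) (eps D M)"])
    (auto simp: transpose_hom transpose_map transpose_hom_mem[OF assms] transpose_map_mem[OF assms]
      transpose_transpose_hom transpose_transpose_map simp del: restrict_apply)

lemma bij_transpose_map:
  assumes "D_frame D M"
  shows "bij_betw (\<lambda>f. compose (carrier M) (Omega_map X (pt D M) f) (eps D M))
    (Top_hom X (pt D M)) (Frm_hom D M (Omega X))"
  by (rule bij_betw_byWitness[where f' = "\<lambda>q. compose (pts X) (pt_map D M (Omega X) q) (eta X)"])
    (auto simp: transpose_hom transpose_map transpose_hom_mem[OF assms] transpose_map_mem[OF assms]
      transpose_transpose_hom transpose_transpose_map simp del: restrict_apply)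

lemma transpose_hom_inverse:
  assumes "D_frame D M" "q \<in> Frm_hom D M (Omega X)"
  shows "compose (carrier M)
    (Omega_map X (pt D M) (compose (pts X) (pt_map D M (Omega X) q) (eta X))) (eps D M) = q"
  by (simp only: transpose_hom[OF assms(2)] transpose_map[OF transpose_hom_mem[OF assms]]
      transpose_transpose_hom[OF assms(2)])

end


section \<open>Functoriality and naturality\<close>

lemma mv_space_over_pt:
  "subquantale D \<Longrightarrow> D_frame D M \<Longrightarrow> mv_space_over D (pt D M)"
  by (simp add: mv_space_over_def laminated_mv_space_pt)

text \<open>The component of \<open>Omega_map X Y f\<close> at \<open>x\<close> is evaluation at
  \<open>f x\<close>, which is a point by \<open>eta_points\<close>.\<close>

lemma Omega_map_hom:
  assumes "mv_space_over D X" "mv_space_over D Y" and f: "f \<in> Top_hom X Y"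
  shows "Omega_map X Y f \<in> Frm_hom D (Omega Y) (Omega X)"
proof -
  interpret X: mv_space_over D X by fact
  interpret Y: mv_space_over D Y by fact
  have "(\<lambda>\<alpha>\<in>opens Y. Omega_map X Y f \<alpha> x) = eta Y (f x)" if "x \<in> pts X" for x
    using f that by (auto simp: Omega_map_def eta_def Top_hom_def compose_def cong: restrict_cong)
  moreover have "Omega_map X Y f \<in> opens Y \<rightarrow>\<^sub>E opens X"
    using f by (auto simp: Omega_map_def Top_hom_def)
  moreover have "f x \<in> pts Y" if "x \<in> pts X" for x
    using f that by (auto simp: Top_hom_def)
  ultimately show ?thesis
    unfolding X.Frm_hom_Omega_iff[OF Y.D_frame_Omega] by (simp add: Y.eta_points)
qed

lemma Omega_map_id:
  assumes "mv_space_over D X"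
  shows "Omega_map X X (\<lambda>x\<in>pts X. x) = (\<lambda>\<alpha>\<in>opens X. \<alpha>)"
proof -
  have "compose (pts X) \<alpha> (\<lambda>x\<in>pts X. x) = \<alpha>" if "\<alpha> \<in> opens X" for \<alpha>
    using mv_space_over.opens_ext[OF assms that]
    by (auto simp: compose_def extensional_def fun_eq_iff)
  then show ?thesis
    by (auto simp: Omega_map_def cong: restrict_cong)
qed

lemma Omega_map_compose:
  assumes f: "f \<in> Top_hom X Y" and g: "g \<in> Top_hom Y Z"
  shows "Omega_map X Z (compose (pts X) g f) = compose (opens Z) (Omega_map X Y f) (Omega_map Y Z g)"
proof -
  \<comment> \<open>The second fact places the intermediate composite in the domain of
    \<open>Omega_map X Y f\<close>; the rest is associativity of composition.\<close>
  have "f \<in> pts X \<rightarrow> pts Y" "\<And>\<alpha>. \<alpha> \<in> opens Z \<Longrightarrow> compose (pts Y) \<alpha> g \<in> opens Y"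
    using f g by (auto simp: Top_hom_def)
  then show ?thesis
    unfolding Omega_map_def compose_def[of "opens Z"]
    by (intro restrict_ext) (simp add: compose_assoc)
qed

text \<open>A point after a homomorphism is a point, and the hat of \<open>a\<close> pulls back to
  the hat of \<open>q a\<close>, which is open.\<close>

lemma pt_map_hom:
  assumes "D_frame D L" and q: "q \<in> Frm_hom D L M"
  shows "pt_map D L M q \<in> Top_hom (pt D M) (pt D L)"
proof -
  have "compose (carrier L) p q \<in> points D L" if "p \<in> points D M" for p
    using that Frm_comp[OF assms(1) q] by (simp add: points_def)
  moreover have "(\<lambda>p\<in>points D M. pt_map D L M q p a) = hat D M (q a)" if "a \<in> carrier L" for a
    using that by (auto simp: pt_map_def hat_def compose_def)
  moreover have "q a \<in> carrier M" if "a \<in> carrier L" for a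
    using q that by (auto simp: Frm_hom_def)
  ultimately show ?thesis
    unfolding Top_hom_pt_iff by (auto simp: pt_map_def)
qed

lemma pt_map_id: "pt_map D M M (\<lambda>a\<in>carrier M. a) = (\<lambda>p\<in>points D M. p)"
  unfolding pt_map_def
  by (rule restrict_ext)
    (auto simp: compose_def fun_eq_iff dest!: points_extensional intro: extensional_arb[symmetric])

lemma pt_map_compose:
  assumes "D_frame D L" "q \<in> Frm_hom D K L" "s \<in> Frm_hom D L M"
  shows "pt_map D K M (compose (carrier K) s q) =
    compose (points D M) (pt_map D K L q) (pt_map D L M s)"
proof -
  have "q \<in> carrier K \<rightarrow> carrier L"
    using assms(2) by (auto simp: Frm_hom_def)
  moreover have "compose (carrier L) p s \<in> points D L" if "p \<in> points D M" for p
    using that Frm_comp[OF assms(1,3)] by (simp add: points_def)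
  ultimately show ?thesis
    unfolding pt_map_def compose_def[of "points D M"]
    by (intro restrict_ext) (simp add: compose_assoc)
qed

section \<open>Naturality of the unit and the counit\<close>

lemma eta_natural:
  assumes "mv_space_over D X" "mv_space_over D Y" and f: "f \<in> Top_hom X Y"
  shows "compose (pts X) (pt_map D (Omega Y) (Omega X) (Omega_map X Y f)) (eta X) =
    compose (pts X) (eta Y) f"
  \<comment> \<open>The left side is the transpose of \<open>Omega_map X Y f\<close>; both sides
    send \<open>x\<close> to evaluation at \<open>f x\<close>.\<close>
  unfolding mv_space_over.transpose_hom[OF assms(1) Omega_map_hom[OF assms]]
  unfolding compose_def
  using f by (intro restrict_ext) (auto simp: eta_def Omega_map_def Top_hom_def compose_def fun_eq_iff)

lemma eps_hom:
  assumes "subquantale D" "D_frame D M"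
  shows "eps D M \<in> Frm_hom D M (Omega (pt D M))"
proof -
  interpret mv_space_over D "pt D M"
    using assms by (rule mv_space_over_pt)
  have "(\<lambda>p\<in>points D M. p) \<in> Top_hom (pt D M) (pt D M)"
    using Top_id[OF X] by simp
  from transpose_map_mem[OF assms(2) this] show ?thesis
    by (simp add: eps_def hat_def cong: restrict_cong)
qed

text \<open>Both composites send \<open>a\<close> to p \<mapsto> p (q a) on the points of
  \<open>M\<close>.\<close>

lemma eps_natural:
  assumes "D_frame D L" and q: "q \<in> Frm_hom D L M"
  shows "compose (carrier L) (Omega_map (pt D M) (pt D L) (pt_map D L M q)) (eps D L) =
    compose (carrier L) (eps D M) q"
proof -
  have "compose (carrier L) p q \<in> points D L" if "p \<in> points D M" for p
    using that Frm_comp[OF assms(1) q] by (simp add: points_def)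
  moreover have "q a \<in> carrier M" if "a \<in> carrier L" for a
    using q that by (auto simp: Frm_hom_def)
  ultimately show ?thesis
    unfolding compose_def[of "carrier L"]
    by (intro restrict_ext)
      (auto simp: Omega_map_def pt_map_def eps_def hat_def compose_def fun_eq_iff)
qed

section \<open>The triangle identities and the adjunction\<close>

lemma triangle_Omega:
  assumes "mv_space_over D X"
  shows "compose (opens X) (Omega_map X (pt D (Omega X)) (eta X)) (eps D (Omega X)) = (\<lambda>\<alpha>\<in>opens X. \<alpha>)"
proof -
  interpret mv_space_over D X by fact
  show ?thesis
    \<comment> \<open>The composite is the transpose of the unit, so it sends \<alpha> to x
      \<mapsto> \<alpha> x.\<close>
    using transpose_map[OF eta_Top_hom] by (simp add: eta_evaluation cong: restrict_cong)
qed

lemma triangle_pt: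
  assumes "subquantale D" "D_frame D M"
  shows "compose (points D M) (pt_map D M (Omega (pt D M)) (eps D M)) (eta (pt D M)) = (\<lambda>p\<in>points D M. p)"
proof -
  interpret mv_space_over D "pt D M"
    using assms by (rule mv_space_over_pt)
  have "(\<lambda>a\<in>carrier M. eps D M a p) = p" if "p \<in> points D M" for p
    using that points_extensional[OF that] by (auto simp: eps_def hat_def extensional_def)
  then show ?thesis
    \<comment> \<open>The composite is the transpose of the counit, so it sends \<open>p\<close> to
      a \<mapsto> p a.\<close>
    using transpose_hom[OF eps_hom[OF assms]] by (simp cong: restrict_cong)
qed

theorem theorem4p3:
  fixes D :: "real set"
  assumes "subquantale D"
  shows
    \<comment> \<open>\<open>\<Omega>\<close> is a functor from \<open>Top(D)\<close> to the opposite of \<open>Frm(D)\<close>\<close>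
    "(\<forall>X::'x mv_space. laminated_mv_space D X \<longrightarrow> D_frame D (Omega X)) \<and>
     (\<forall>(X::'x mv_space) (Y::'y mv_space) f.
        laminated_mv_space D X \<and> laminated_mv_space D Y \<and> f \<in> Top_hom X Y \<longrightarrow>
        Omega_map X Y f \<in> Frm_hom D (Omega Y) (Omega X)) \<and>
     (\<forall>X::'x mv_space. laminated_mv_space D X \<longrightarrow>
        Omega_map X X (\<lambda>x\<in>pts X. x) = (\<lambda>\<alpha>\<in>carrier (Omega X). \<alpha>)) \<and>
     (\<forall>(X::'x mv_space) (Y::'y mv_space) (Z::'z mv_space) f g.
        laminated_mv_space D X \<and> laminated_mv_space D Y \<and> laminated_mv_space D Z \<and>
        f \<in> Top_hom X Y \<and> g \<in> Top_hom Y Z \<longrightarrow>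
        Omega_map X Z (compose (pts X) g f) =
          compose (carrier (Omega Z)) (Omega_map X Y f) (Omega_map Y Z g)) \<and>
     \<comment> \<open>\<open>pt\<close> is a functor from the opposite of \<open>Frm(D)\<close> to \<open>Top(D)\<close>\<close>
     (\<forall>M::'m D_frame_struct. D_frame D M \<longrightarrow> laminated_mv_space D (pt D M)) \<and>
     (\<forall>(L::'l D_frame_struct) (M::'m D_frame_struct) q.
        D_frame D L \<and> D_frame D M \<and> q \<in> Frm_hom D L M \<longrightarrow>
        pt_map D L M q \<in> Top_hom (pt D M) (pt D L)) \<and>
     (\<forall>M::'m D_frame_struct. D_frame D M \<longrightarrow>
        pt_map D M M (\<lambda>a\<in>carrier M. a) = (\<lambda>p\<in>pts (pt D M). p)) \<and>
     (\<forall>(K::'k D_frame_struct) (L::'l D_frame_struct) (M::'m D_frame_struct) q s.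
        D_frame D K \<and> D_frame D L \<and> D_frame D M \<and>
        q \<in> Frm_hom D K L \<and> s \<in> Frm_hom D L M \<longrightarrow>
        pt_map D K M (compose (carrier K) s q) =
          compose (pts (pt D M)) (pt_map D K L q) (pt_map D L M s)) \<and>
     \<comment> \<open>the unit is a natural transformation from the identity to \<open>pt \<circ> \<Omega>\<close>\<close>
     (\<forall>X::'x mv_space. laminated_mv_space D X \<longrightarrow> eta X \<in> Top_hom X (pt D (Omega X))) \<and>
     (\<forall>(X::'x mv_space) (Y::'y mv_space) f.
        laminated_mv_space D X \<and> laminated_mv_space D Y \<and> f \<in> Top_hom X Y \<longrightarrow>
        compose (pts X) (pt_map D (Omega Y) (Omega X) (Omega_map X Y f)) (eta X) =
          compose (pts X) (eta Y) f) \<and>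
     \<comment> \<open>the counit, written as a homomorphism from \<open>M\<close> to \<open>\<Omega> (pt M)\<close>, is natural\<close>
     (\<forall>M::'m D_frame_struct. D_frame D M \<longrightarrow> eps D M \<in> Frm_hom D M (Omega (pt D M))) \<and>
     (\<forall>(L::'l D_frame_struct) (M::'m D_frame_struct) q.
        D_frame D L \<and> D_frame D M \<and> q \<in> Frm_hom D L M \<longrightarrow>
        compose (carrier L) (Omega_map (pt D M) (pt D L) (pt_map D L M q)) (eps D L) =
          compose (carrier L) (eps D M) q) \<and>
     \<comment> \<open>triangle identities\<close>
     (\<forall>X::'x mv_space. laminated_mv_space D X \<longrightarrow>
        compose (carrier (Omega X)) (Omega_map X (pt D (Omega X)) (eta X)) (eps D (Omega X)) =
          (\<lambda>\<alpha>\<in>carrier (Omega X). \<alpha>)) \<and>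
     (\<forall>M::'m D_frame_struct. D_frame D M \<longrightarrow>
        compose (pts (pt D M)) (pt_map D M (Omega (pt D M)) (eps D M)) (eta (pt D M)) =
          (\<lambda>p\<in>pts (pt D M). p)) \<and>
     \<comment> \<open>the resulting mutually inverse bijections between the hom-sets\<close>
     (\<forall>(X::'x mv_space) (M::'m D_frame_struct).
        laminated_mv_space D X \<and> D_frame D M \<longrightarrow>
        bij_betw (\<lambda>q. compose (pts X) (pt_map D M (Omega X) q) (eta X))
          (Frm_hom D M (Omega X)) (Top_hom X (pt D M)) \<and>
        bij_betw (\<lambda>f. compose (carrier M) (Omega_map X (pt D M) f) (eps D M))
          (Top_hom X (pt D M)) (Frm_hom D M (Omega X)) \<and>
        (\<forall>q \<in> Frm_hom D M (Omega X).
          compose (carrier M)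
            (Omega_map X (pt D M) (compose (pts X) (pt_map D M (Omega X) q) (eta X))) (eps D M) = q))"
  unfolding pt_simps Omega_simps
  by (insert assms, intro conjI allI impI ballI; (elim conjE)?;
      rule mv_space_over.D_frame_Omega Omega_map_hom Omega_map_id Omega_map_compose
        laminated_mv_space_pt pt_map_hom pt_map_id pt_map_compose
        mv_space_over.eta_Top_hom eta_natural eps_hom eps_natural triangle_Omega triangle_pt
        mv_space_over.bij_transpose_hom mv_space_over.bij_transpose_map
        mv_space_over.transpose_hom_inverse;
      (assumption | rule mv_space_over.intro)+)

end
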